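(* Consider a pigeonhole PPS scenario (as defined in the context) with pre-selected state $\rho_I$ and post-selected state $\rho_F$ on $(\mathbb{C}^2)^{\otimes 3}$ and product basis $C=\{|c_1c_2c_3\rangle\}_{c_i\in\{L,R\}}$. If either $\rho_I$ or $\rho_F$ is incoherent with respect to the basis $C$, then the ABL statistics satisfy $$\sum_{\{i,j\}\in P_3}p(\mathrm{same}_{ij}\mid\rho_I,\rho_F,\mathcal{M}_{ij})\ge 1 .$$
   Context: A state on a finite-dimensional Hilbert space is a density operator (positive semidefinite, trace one). A state $\rho$ is incoherent with respect to an orthonormal basis $\{|a\rangle\}_a$ if $\langle a|\rho|a'\rangle=0$ for all $a\ne a'$, and coherent otherwise. Pigeonhole PPS scenario. Let $\{|L\rangle,|R\rangle\}$ be an orthonormal basis of $\mathbb{C}^2$ and $C=\{|c_1c_2c_3\rangle=|c_1\rangle\otimes|c_2\rangle\otimes|c_3\rangle\}_{c_i\in\{L,R\}}$ the product orthonormal basis of $\mathcal{H}=(\mathbb{C}^2)^{\otimes 3}$. Let $P_3=\{\{i,j\}: i,j\in\{1,2,3\},\ i\ne j\}$ be the set of the three unordered pairs. For $\{i,j\}\in P_3$ let $$\Pi^{\mathrm{same}}_{ij}=|LL\rangle\langle LL|_{ij}\otimes\mathbb{1}_2+|RR\rangle\langle RR|_{ij}\otimes\mathbb{1}_2,\qquad \Pi^{\mathrm{diff}}_{ij}=\mathbb{1}_8-\Pi^{\mathrm{same}}_{ij},$$ where the subscript $ij$ means acting on tensor factors $i,j$ and $\mathbb{1}_2$ acts on the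 remaining factor; i.e. $\Pi^{\mathrm{same}}_{ij}$ is the orthogonal projector onto the span of the basis vectors $|c_1c_2c_3\rangle$ with $c_i=c_j$. The intermediate measurement is $\mathcal{M}_{ij}=\{\Pi^{\mathrm{same}}_{ij},\Pi^{\mathrm{diff}}_{ij}\}$ with outcomes $\mathrm{same}_{ij},\mathrm{diff}_{ij}$. The data are states $\rho_I$ (pre-selected) and $\rho_F$ (post-selected) on $\mathcal{H}$; the post-selection measurement is $\mathcal{M}_F=\{\rho_F,\mathbb{1}-\rho_F\}$, with "pass" denoting outcome $\rho_F$. The probabilities (Lüders rule) are $$p(\mathrm{same}_{ij},\mathrm{pass})=\mathrm{Tr}[\rho_F\Pi^{\mathrm{same}}_{ij}\rho_I\Pi^{\mathrm{same}}_{ij}],\quad p(\mathrm{diff}_{ij},\mathrm{pass})=\mathrm{Tr}[\rho_F\Pi^{\mathrm{diff}}_{ij}\rho_I\Pi^{\mathrm{diff}}_{ij}],\quad p(\mathrm{pass}\mid\rho_I,\mathcal{M}_F)=\mathrm{Tr}[\rho_F\rho_I].$$ The scenario is required to satisfy: (i) operational non-disturbance: $p(\mathrm{same}_{ij},\mathrm{pass})+p(\mathrm{diff}_{ij},\mathrm{pass})=p(\mathrm{pass}\mid\rho_I,\mathcal{M}_F)$ for every $\{i,j\}\in P_3$; (ii) $p(\mathrm{pass}\mid\rho_I,\mathcal{M}_F)=\mathrm{Tr}[\rho_F\rho_I]\ne 0$; (iii) when the three pair-checks are performed sequentially (in any order) on $\rho_I$ without post-selection, the probability of obtaining all three outcomes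 $\mathrm{diff}$ is zero: $p(\mathrm{diff}_{12},\mathrm{diff}_{13},\mathrm{diff}_{23}\mid\rho_I,\mathcal{M}_{12},\mathcal{M}_{13},\mathcal{M}_{23})=\mathrm{Tr}[K\rho_I K^\dagger]=0$ with $K=\Pi^{\mathrm{diff}}_{23}\Pi^{\mathrm{diff}}_{13}\Pi^{\mathrm{diff}}_{12}$, and likewise for the other orders. ABL rule: for $\{i,j\}\in P_3$, $$p(\mathrm{same}_{ij}\mid\rho_I,\rho_F,\mathcal{M}_{ij})=\frac{p(\mathrm{same}_{ij},\mathrm{pass})}{p(\mathrm{same}_{ij},\mathrm{pass})+p(\mathrm{diff}_{ij},\mathrm{pass})}.$$ *)

theory Defs
  imports "HOL-Analysis.Analysis"
begin

section \<open>Finite-dimensional Hilbert spaces over the complex numbers\<close>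

(* The library inner product on complex^'n is the real one, hence the separate sesquilinear form
   (antilinear in the first argument). *)
definition braket :: "complex ^ 'n \<Rightarrow> complex ^ 'n \<Rightarrow> complex" where
  "braket u v = (\<Sum>i\<in>UNIV. cnj (u $ i) * v $ i)"

definition ketbra :: "complex ^ 'n \<Rightarrow> complex ^ 'n \<Rightarrow> complex ^ 'n ^ 'n" where
  "ketbra u v = (\<chi> i j. u $ i * cnj (v $ j))"

definition dagger :: "complex ^ 'n ^ 'm \<Rightarrow> complex ^ 'm ^ 'n" where
  "dagger A = (\<chi> i j. cnj (A $ j $ i))"

definition positive_semidefinite :: "complex ^ 'n ^ 'n \<Rightarrow> bool" where
  "positive_semidefinite A \<longleftrightarrow> dagger A = A \<and> (\<forall>v. 0 \<le> Re (braket v (A *v v)))"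

definition density_operator :: "complex ^ 'n ^ 'n \<Rightarrow> bool" where
  "density_operator \<rho> \<longleftrightarrow> positive_semidefinite \<rho> \<and> trace \<rho> = 1"

definition orthonormal_basis :: "('a \<Rightarrow> complex ^ 'n) \<Rightarrow> bool" where
  "orthonormal_basis b \<longleftrightarrow>
     (\<forall>a a'. braket (b a) (b a') = (if a = a' then 1 else 0)) \<and> vec.span (range b) = UNIV"

definition incoherent :: "('a \<Rightarrow> complex ^ 'n) \<Rightarrow> complex ^ 'n ^ 'n \<Rightarrow> bool" where
  "incoherent b \<rho> \<longleftrightarrow> (\<forall>a a'. a \<noteq> a' \<longrightarrow> braket (b a) (\<rho> *v b a') = 0)"

(* The tensor power of complex^'n over the factors 'k has coordinates indexed by functions
   'k \<Rightarrow> 'n, one index for each factor. *)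
definition tensor_ket :: "('k::finite \<Rightarrow> complex ^ 'n::finite) \<Rightarrow> complex ^ ('k \<Rightarrow> 'n)" where
  "tensor_ket v = (\<chi> r. \<Prod>k\<in>UNIV. v k $ r k)"

definition tensor_op ::
  "('k::finite \<Rightarrow> complex ^ 'n::finite ^ 'n) \<Rightarrow> complex ^ ('k \<Rightarrow> 'n) ^ ('k \<Rightarrow> 'n)" where
  "tensor_op A = (\<chi> r s. \<Prod>k\<in>UNIV. A k $ r k $ s k)"


section \<open>The pigeonhole scenario\<close>

datatype side = L | R

(* The type 3 has the three elements 1, 2 and 3 = 0. *)
type_synonym ket8 = "complex ^ (3 \<Rightarrow> 2)"
type_synonym op8 = "complex ^ (3 \<Rightarrow> 2) ^ (3 \<Rightarrow> 2)"

definition product_basis :: "(side \<Rightarrow> complex ^ 2) \<Rightarrow> (3 \<Rightarrow> side) \<Rightarrow> ket8" where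
  "product_basis e c = tensor_ket (\<lambda>k. e (c k))"

definition P3 :: "3 set set" where
  "P3 = {{i, j} | i j. i \<noteq> j}"

definition Pi_same :: "(side \<Rightarrow> complex ^ 2) \<Rightarrow> 3 set \<Rightarrow> op8" where
  "Pi_same e p =
     tensor_op (\<lambda>k. if k \<in> p then ketbra (e L) (e L) else mat 1) +
     tensor_op (\<lambda>k. if k \<in> p then ketbra (e R) (e R) else mat 1)"

definition Pi_diff :: "(side \<Rightarrow> complex ^ 2) \<Rightarrow> 3 set \<Rightarrow> op8" where
  "Pi_diff e p = mat 1 - Pi_same e p"

(* The traces below are real for density operators; Re only changes the type. *)
definition prob_same_pass :: "(side \<Rightarrow> complex ^ 2) \<Rightarrow> op8 \<Rightarrow> op8 \<Rightarrow> 3 set \<Rightarrow> real" where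
  "prob_same_pass e \<rho>\<^sub>I \<rho>\<^sub>F p = Re (trace (\<rho>\<^sub>F ** Pi_same e p ** \<rho>\<^sub>I ** Pi_same e p))"

definition prob_diff_pass :: "(side \<Rightarrow> complex ^ 2) \<Rightarrow> op8 \<Rightarrow> op8 \<Rightarrow> 3 set \<Rightarrow> real" where
  "prob_diff_pass e \<rho>\<^sub>I \<rho>\<^sub>F p = Re (trace (\<rho>\<^sub>F ** Pi_diff e p ** \<rho>\<^sub>I ** Pi_diff e p))"

definition prob_pass :: "op8 \<Rightarrow> op8 \<Rightarrow> real" where
  "prob_pass \<rho>\<^sub>I \<rho>\<^sub>F = Re (trace (\<rho>\<^sub>F ** \<rho>\<^sub>I))"

(* Pairs are checked in list order, so the projector of the first one acts first (rightmost). *)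
definition diff_sequence :: "(side \<Rightarrow> complex ^ 2) \<Rightarrow> 3 set list \<Rightarrow> op8" where
  "diff_sequence e ps = foldl (\<lambda>K p. Pi_diff e p ** K) (mat 1) ps"

definition prob_all_diff :: "(side \<Rightarrow> complex ^ 2) \<Rightarrow> op8 \<Rightarrow> 3 set list \<Rightarrow> real" where
  "prob_all_diff e \<rho>\<^sub>I ps = Re (trace (diff_sequence e ps ** \<rho>\<^sub>I ** dagger (diff_sequence e ps)))"

definition pigeonhole_scenario :: "(side \<Rightarrow> complex ^ 2) \<Rightarrow> op8 \<Rightarrow> op8 \<Rightarrow> bool" where
  "pigeonhole_scenario e \<rho>\<^sub>I \<rho>\<^sub>F \<longleftrightarrow>
     orthonormal_basis e \<and> density_operator \<rho>\<^sub>I \<and> density_operator \<rho>\<^sub>F \<and>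
     (\<forall>p\<in>P3. prob_same_pass e \<rho>\<^sub>I \<rho>\<^sub>F p + prob_diff_pass e \<rho>\<^sub>I \<rho>\<^sub>F p = prob_pass \<rho>\<^sub>I \<rho>\<^sub>F) \<and>
     prob_pass \<rho>\<^sub>I \<rho>\<^sub>F \<noteq> 0 \<and>
     (\<forall>ps. distinct ps \<and> set ps = P3 \<longrightarrow> prob_all_diff e \<rho>\<^sub>I ps = 0)"

definition abl_same :: "(side \<Rightarrow> complex ^ 2) \<Rightarrow> op8 \<Rightarrow> op8 \<Rightarrow> 3 set \<Rightarrow> real" where
  "abl_same e \<rho>\<^sub>I \<rho>\<^sub>F p =
     prob_same_pass e \<rho>\<^sub>I \<rho>\<^sub>F p / (prob_same_pass e \<rho>\<^sub>I \<rho>\<^sub>F p + prob_diff_pass e \<rho>\<^sub>I \<rho>\<^sub>F p)"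

end

(* Resolving each projector in the product basis, Tr[F S I S] becomes a double sum of
   <c|I|d><d|F|c>, in which incoherence of I or of F leaves only the terms c = d.  Hence
   p(same_ij, pass) is the total weight <c|I|c><c|F|c> \<ge> 0 of the strings c with c_i = c_j.
   Every string has such a pair (three letters, two values), so the three totals cover
   all strings and add up to at least Tr[F I], which is each ABL denominator by
   non-disturbance. *)

theory Submission imports Defs begin

lemma UNIV_side: "UNIV = {L, R}"
  using side.exhaust by blast

text \<open>Makes the type of strings \<open>3 \<Rightarrow> side\<close> finite, so that a sum over
  all of them has its intended value and not the default 0.\<close>

instance side :: finite
  by standard (simp add: UNIV_side)

lemma matrix_mult_sum_right:
  fixes A :: "'a::semiring_1 ^ 'n ^ 'm" and f :: "'i \<Rightarrow> 'a ^ 'p ^ 'n"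
  shows "A ** (\<Sum>i\<in>S. f i) = (\<Sum>i\<in>S. A ** f i)"
  by (simp add: vec_eq_iff matrix_matrix_mult_def sum_component sum_distrib_left sum.swap[of _ S])

lemma matrix_mult_sum_left:
  fixes A :: "'a::semiring_1 ^ 'p ^ 'n" and f :: "'i \<Rightarrow> 'a ^ 'n ^ 'm"
  shows "(\<Sum>i\<in>S. f i) ** A = (\<Sum>i\<in>S. f i ** A)"
  by (simp add: vec_eq_iff matrix_matrix_mult_def sum_component sum_distrib_right sum.swap[of _ S])

lemma trace_sum:
  fixes f :: "'i \<Rightarrow> 'a::semiring_1 ^ 'n ^ 'n"
  shows "trace (\<Sum>i\<in>S. f i) = (\<Sum>i\<in>S. trace (f i))"
  by (simp add: trace_def sum_component sum.swap[of _ S])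

lemma matrix_mult_ketbra: "A ** ketbra u v = ketbra (A *v u) v"
  by (simp add: vec_eq_iff matrix_matrix_mult_def matrix_vector_mult_def ketbra_def
      sum_distrib_right mult.assoc)

lemma trace_ketbra: "trace (ketbra u v) = braket v u"
  by (simp add: trace_def ketbra_def braket_def mult.commute)

lemma ketbra_mult_vector: "ketbra u v *v w = braket v w *s u"
  by (simp add: vec_eq_iff matrix_vector_mult_def ketbra_def braket_def sum_distrib_left
      mult_ac)

lemma braket_scale_right: "braket v (c *s w) = c * braket v w"
  by (simp add: braket_def sum_distrib_left mult_ac)

text \<open>The rank-one factors cut the operator product into scalars: the whole product is
  \<open>ketbra\<close> of \<open>braket u (B *v v) *s (A *v u)\<close> and
  \<open>v\<close>.\<close>

lemma trace_ketbra_sandwich: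
  "trace (A ** ketbra u u ** B ** ketbra v v) = braket u (B *v v) * braket v (A *v u)"
  by (simp add: matrix_mult_ketbra trace_ketbra matrix_vector_mul_assoc[symmetric]
      ketbra_mult_vector vec.scale braket_scale_right del: matrix_vector_mul_assoc)

text \<open>The expansion map is linear and fixes each basis vector, hence fixes their span, which
  is the whole space.\<close>

lemma orthonormal_basis_expansion:
  fixes b :: "'a::finite \<Rightarrow> complex ^ 'n"
  assumes "orthonormal_basis b"
  shows "(\<Sum>a\<in>UNIV. braket (b a) v *s b a) = v"
proof -
  let ?E = "\<lambda>v. \<Sum>a\<in>UNIV. braket (b a) v *s b a"
  have orth: "braket (b a) (b a') = (if a = a' then 1 else 0)" for a a'
    using assms by (simp add: orthonormal_basis_def)
  have "v \<in> vec.span (range b)"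
    using assms by (simp add: orthonormal_basis_def)
  then show ?thesis
  proof (induction rule: vec.span_induct_alt)
    case base
    show ?case by (simp add: braket_def)
  next
    case (step c x y)
    then obtain a' where x: "x = b a'" by blast
    have "?E x = (\<Sum>a\<in>UNIV. if a = a' then b a else 0)"
      unfolding x orth by (intro sum.cong) auto
    then have "?E x = x" by (simp add: x)
    moreover have "?E (c *s x + y) = c *s ?E x + ?E y"
      by (simp add: vec_eq_iff sum_component braket_def algebra_simps sum.distrib sum_distrib_left)
    ultimately show ?case using step by simp
  qed
qed

lemma sum_ketbra_orthonormal_basis:
  fixes b :: "'a::finite \<Rightarrow> complex ^ 'n"
  assumes "orthonormal_basis b"
  shows "(\<Sum>a\<in>UNIV. ketbra (b a) (b a)) = mat 1"
proof -
  have "(\<Sum>a\<in>UNIV. ketbra (b a) (b a)) *v v = mat 1 *v v" for v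
  proof -
    have "(\<Sum>a\<in>UNIV. ketbra (b a) (b a)) *v v = (\<Sum>a\<in>UNIV. ketbra (b a) (b a) *v v)"
      by (simp add: vec_eq_iff matrix_vector_mult_def sum_component sum_distrib_right
          sum.swap[of _ "UNIV :: 'a set"])
    then show ?thesis
      using orthonormal_basis_expansion[OF assms, of v] by (simp add: ketbra_mult_vector)
  qed
  then show ?thesis by (simp add: matrix_eq)
qed

text \<open>Multilinearity: a product of sums expands into a sum over choice functions. Letting
  \<open>B\<close> depend on the factor covers both a prescribed letter (a singleton) and the
  identity (\<open>UNIV\<close>).\<close>

lemma tensor_op_sum_ketbra:
  fixes e :: "side \<Rightarrow> complex ^ 2"
  shows "tensor_op (\<lambda>k. \<Sum>s\<in>B k. ketbra (e s) (e s)) =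
    (\<Sum>c\<in>{c. \<forall>k. c k \<in> B k}. ketbra (product_basis e c) (product_basis e c))"
proof -
  \<comment> \<open>\<open>prod_sum_PiE\<close> sums over extensional functions; on the domain
    \<open>UNIV\<close> these are all functions.\<close>
  have "{c. \<forall>k. c k \<in> B k} = PiE UNIV B" by (auto simp: PiE_def Pi_def)
  then show ?thesis
    by (simp add: vec_eq_iff tensor_op_def sum_component prod_sum_PiE ketbra_def
        product_basis_def tensor_ket_def prod.distrib)
qed

lemma sum_ketbra_product_basis:
  assumes "orthonormal_basis e"
  shows "(\<Sum>c\<in>UNIV. ketbra (product_basis e c) (product_basis e c)) = mat 1"
proof -
  have "tensor_op (\<lambda>k. mat 1) = (mat 1 :: op8)"
    by (auto simp: vec_eq_iff tensor_op_def mat_def fun_eq_iff)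
  then show ?thesis
    using tensor_op_sum_ketbra[where B = "\<lambda>k. UNIV" and e = e] sum_ketbra_orthonormal_basis[OF assms] by simp
qed

text \<open>For \<open>p = {i, j}\<close> this says \<open>c i = c j\<close>; asking for a common
  letter avoids ordering the pair.\<close>

definition same_side_on :: "3 set \<Rightarrow> (3 \<Rightarrow> side) set" where
  "same_side_on p = {c. \<exists>s. \<forall>k\<in>p. c k = s}"

text \<open>The two tensor summands resolve into the strings constantly \<open>L\<close> on
  \<open>p\<close> and those constantly \<open>R\<close> on \<open>p\<close>. These classes are
  disjoint because \<open>p\<close> is nonempty; for \<open>p = {}\<close> both summands would be
  the identity.\<close>

lemma Pi_same_eq_sum_ketbra:
  assumes "orthonormal_basis e" and "p \<noteq> {}"
  shows "Pi_same e p = (\<Sum>c\<in>same_side_on p. ketbra (product_basis e c) (product_basis e c))"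
proof -
  let ?C = "\<lambda>s. {c. \<forall>k. c k \<in> (if k \<in> p then {s} else UNIV)} :: (3 \<Rightarrow> side) set"
  have "tensor_op (\<lambda>k. if k \<in> p then ketbra (e s) (e s) else mat 1) =
      (\<Sum>c\<in>?C s. ketbra (product_basis e c) (product_basis e c))" for s
    unfolding tensor_op_sum_ketbra[symmetric]
    by (rule arg_cong[where f = tensor_op])
       (simp add: fun_eq_iff sum_ketbra_orthonormal_basis[OF assms(1)])
  moreover have "same_side_on p = ?C L \<union> ?C R"
  proof -
    have "(\<exists>s. Q s) \<longleftrightarrow> Q L \<or> Q R" for Q by (metis side.exhaust)
    then show ?thesis by (auto simp: same_side_on_def)
  qed
  moreover have "?C L \<inter> ?C R = {}"
  proof (rule equals0I)
    fix c assume c: "c \<in> ?C L \<inter> ?C R"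
    obtain k where k: "k \<in> p" using assms(2) by blast
    from c have "c k \<in> (if k \<in> p then {L} else UNIV)" "c k \<in> (if k \<in> p then {R} else UNIV)"
      by blast+
    with k show False by simp
  qed
  ultimately show ?thesis by (simp add: Pi_same_def sum.union_disjoint)
qed

lemma trace_incoherent_sandwich:
  assumes "incoherent b A \<or> incoherent b B"
  shows "trace (B ** (\<Sum>c\<in>S. ketbra (b c) (b c)) ** A ** (\<Sum>c\<in>S. ketbra (b c) (b c))) =
    (\<Sum>c\<in>S. braket (b c) (A *v b c) * braket (b c) (B *v b c))"
proof (cases "finite S")
  case True
  have "trace (B ** (\<Sum>c\<in>S. ketbra (b c) (b c)) ** A ** (\<Sum>c\<in>S. ketbra (b c) (b c))) =
      (\<Sum>d\<in>S. \<Sum>c\<in>S. braket (b c) (A *v b d) * braket (b d) (B *v b c))"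
    by (simp only: matrix_mult_sum_right matrix_mult_sum_left trace_sum trace_ketbra_sandwich)
  also have "\<dots> = (\<Sum>d\<in>S. \<Sum>c\<in>S.
      if c = d then braket (b d) (A *v b d) * braket (b d) (B *v b d) else 0)"
    \<comment> \<open>For \<open>c \<noteq> d\<close> each term has one off-diagonal factor from
      \<open>A\<close> and one from \<open>B\<close>, so incoherence of either operator kills
      it.\<close>
    using assms by (intro sum.cong) (auto simp: incoherent_def)
  finally show ?thesis using True by simp
\<comment> \<open>For infinite \<open>S\<close> all the sums are 0 by convention, and so are both
  sides.\<close>
qed (simp add: matrix_matrix_mult_def trace_def)

lemma braket_hermitian:
  assumes "dagger A = A"
  shows "cnj (braket v (A *v v)) = braket v (A *v v)"
proof -
  have "cnj (A $ i $ j) = A $ j $ i" for i j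
    using arg_cong[OF assms, of "\<lambda>M. M $ j $ i"] by (simp add: dagger_def)
  then show ?thesis
    by (simp add: braket_def matrix_vector_mult_def sum_distrib_left mult_ac)
       (subst sum.swap, simp add: mult_ac)
qed

text \<open>Hermiticity makes the first factor real, so the real part of the product is the product
  of two nonnegative real parts.\<close>

lemma Re_braket_mult_nonneg:
  assumes "positive_semidefinite A" and "positive_semidefinite B"
  shows "0 \<le> Re (braket v (A *v v) * braket v (B *v v))"
proof -
  have "Im (braket v (A *v v)) = 0"
    using braket_hermitian[of A v] assms(1)
    by (simp add: positive_semidefinite_def complex_eq_iff)
  then show ?thesis using assms by (simp add: positive_semidefinite_def)
qed

lemma pigeonhole_pair: "\<exists>p\<in>P3. c \<in> same_side_on p"
proof -
  have "\<not> inj c"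
  proof
    assume "inj c"
    then have "CARD(3) \<le> CARD(side)" by (intro card_inj_on_le[of c]) auto
    then show False by (simp add: UNIV_side)
  qed
  then obtain i j where "i \<noteq> j" "c i = c j" by (auto simp: inj_def)
  then show ?thesis
    by (intro bexI[of _ "{i, j}"]) (auto simp: P3_def same_side_on_def)
qed

theorem mainTheorem3:
  fixes e :: "side \<Rightarrow> complex ^ 2" and \<rho>\<^sub>I \<rho>\<^sub>F :: "complex ^ (3 \<Rightarrow> 2) ^ (3 \<Rightarrow> 2)"
  assumes "pigeonhole_scenario e \<rho>\<^sub>I \<rho>\<^sub>F"
    and "incoherent (product_basis e) \<rho>\<^sub>I \<or> incoherent (product_basis e) \<rho>\<^sub>F"
  shows "(\<Sum>p\<in>P3. abl_same e \<rho>\<^sub>I \<rho>\<^sub>F p) \<ge> 1"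
proof -
  let ?u = "product_basis e"
  define w where "w c = Re (braket (?u c) (\<rho>\<^sub>I *v ?u c) * braket (?u c) (\<rho>\<^sub>F *v ?u c))" for c
  have onb: "orthonormal_basis e"
    and nondisturbance: "\<And>p. p \<in> P3 \<Longrightarrow>
      prob_same_pass e \<rho>\<^sub>I \<rho>\<^sub>F p + prob_diff_pass e \<rho>\<^sub>I \<rho>\<^sub>F p = prob_pass \<rho>\<^sub>I \<rho>\<^sub>F"
    and pass_nonzero: "prob_pass \<rho>\<^sub>I \<rho>\<^sub>F \<noteq> 0"
    using assms(1) by (auto simp: pigeonhole_scenario_def)
  have w_nonneg: "0 \<le> w c" for c
    unfolding w_def using assms(1)
    by (intro Re_braket_mult_nonneg) (simp_all add: pigeonhole_scenario_def density_operator_def)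
  have same: "prob_same_pass e \<rho>\<^sub>I \<rho>\<^sub>F p = (\<Sum>c\<in>same_side_on p. w c)" if "p \<in> P3" for p
  proof -
    have ne: "p \<noteq> {}" using that by (auto simp: P3_def)
    then show ?thesis
      by (simp only: prob_same_pass_def Pi_same_eq_sum_ketbra[OF onb ne]
          trace_incoherent_sandwich[OF assms(2)] Re_sum w_def)
  qed
  \<comment> \<open>For \<open>S = UNIV\<close> both projectors in the sandwich are the identity,
    leaving the trace of \<open>\<rho>\<^sub>F ** \<rho>\<^sub>I\<close>.\<close>
  have pass: "prob_pass \<rho>\<^sub>I \<rho>\<^sub>F = (\<Sum>c\<in>UNIV. w c)"
    using trace_incoherent_sandwich[OF assms(2), of UNIV]
    by (simp add: sum_ketbra_product_basis[OF onb] prob_pass_def w_def del: times_complex.sel)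
  \<comment> \<open>Double counting: the inner sum counts \<open>w c\<close> once for each pair on
    which \<open>c\<close> agrees, hence at least once.\<close>
  have "prob_pass \<rho>\<^sub>I \<rho>\<^sub>F \<le> (\<Sum>c\<in>UNIV. \<Sum>p\<in>P3. if c \<in> same_side_on p then w c else 0)"
    unfolding pass
  proof (rule sum_mono)
    fix c
    obtain p where "p \<in> P3" "c \<in> same_side_on p" using pigeonhole_pair by blast
    then show "w c \<le> (\<Sum>p\<in>P3. if c \<in> same_side_on p then w c else 0)"
      using member_le_sum[of p P3 "\<lambda>p. if c \<in> same_side_on p then w c else 0"] w_nonneg
      by simp
  qed
  also have "\<dots> = (\<Sum>p\<in>P3. \<Sum>c\<in>UNIV. if c \<in> same_side_on p then w c else 0)"
    by (rule sum.swap)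
  also have "\<dots> = (\<Sum>p\<in>P3. prob_same_pass e \<rho>\<^sub>I \<rho>\<^sub>F p)"
    by (intro sum.cong) (simp_all add: same sum.If_cases)
  finally have "prob_pass \<rho>\<^sub>I \<rho>\<^sub>F \<le> (\<Sum>p\<in>P3. prob_same_pass e \<rho>\<^sub>I \<rho>\<^sub>F p)" .
  \<comment> \<open>A sum of nonnegative weights that is nonzero is positive, which permits dividing
    the inequality by it.\<close>
  moreover have "0 < prob_pass \<rho>\<^sub>I \<rho>\<^sub>F"
    using pass_nonzero pass sum_nonneg[of UNIV w] w_nonneg by force
  \<comment> \<open>Non-disturbance gives the three ABL quotients a common denominator.\<close>
  moreover have "(\<Sum>p\<in>P3. abl_same e \<rho>\<^sub>I \<rho>\<^sub>F p) =
      (\<Sum>p\<in>P3. prob_same_pass e \<rho>\<^sub>I \<rho>\<^sub>F p) / prob_pass \<rho>\<^sub>I \<rho>\<^sub>F"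
    by (simp add: abl_same_def nondisturbance sum_divide_distrib)
  ultimately show ?thesis by simp
qed

end
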